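(* Let $(A,\ast,\alpha)$ be a regular Hom-Jacobi-Jordan algebra over a field $\mathbb{K}$. If two linear deformations $\mu^1_t=\ast+t\psi_1$ and $\mu^2_t=\ast+t\psi_2$ of $(A,\ast,\alpha)$ are equivalent, then $\psi_1$ and $\psi_2$ are in the same cohomology class of $H^2_{\alpha}(A,A)$.
   Context: All vector spaces are over a ground field $\mathbb{K}$. A Hom-Jacobi-Jordan algebra is a triple $(A,\ast,\alpha)$ where $A$ is a vector space, $\ast:A\otimes A\to A$ and $\alpha:A\to A$ are linear, such that for all $x,y,z\in A$: $\alpha(x\ast y)=\alpha(x)\ast\alpha(y)$, $x\ast y=y\ast x$, and $(x\ast y)\ast\alpha(z)+(y\ast z)\ast\alpha(x)+(z\ast x)\ast\alpha(y)=0$. It is regular if $\alpha$ is invertible. A morphism $f:(A,\mu,\alpha)\to(B,\nu,\beta)$ is a linear map with $f\circ\alpha=\beta\circ f$ and $f\circ\mu=\nu\circ f^{\otimes2}$. For $n\ge1$, $C^n_\alpha(A,A)$ is the space of $n$-linear maps $f:A^{\otimes n}\to A$ with $f\circ\alpha^{\otimes n}=\alpha\circ f$. A bilinear map $\psi\in C^2_\alpha(A,A)$ generates a linear deformation $\mu_t=\ast+t\psi$ of $(A,\ast,\alpha)$ if $(A,\mu_t,\alpha)$, with $\mu_t(u,v)=u\ast v+t\psi(u,v)$, is a Hom-Jacobi-Jordan algebra for all $t\in\mathbb{K}$. Two linear deformations $\mu_t^1=\ast+t\psi_1$ and $\mu_t^2=\ast+t\psi_2$ are equivalent if there is a linear operator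 $N:A\to A$ such that for all $t\in\mathbb{K}$ the map $T_t=\mathrm{Id}+tN$ is a morphism of Hom-Jacobi-Jordan algebras from $(A,\mu^2_t,\alpha)$ to $(A,\mu^1_t,\alpha)$. The space $H^2_\alpha(A,A)$ is taken with respect to the $\alpha^{-1}$-adjoint representation $ad_{-1}(u)(v)=\alpha^{-1}(u)\ast v$. Explicitly, $H^2_\alpha(A,A)=Z^2_\alpha(A,A)/B^2_\alpha(A,A)$ with $Z^2_\alpha(A,A)=\{\psi\in C^2_\alpha(A,A): d^2_{-1}\psi=0\}$ and $B^2_\alpha(A,A)=\{\delta^1_{-1}N: N\in C^1_\alpha(A,A)\}$, where $$d^2_{-1}\psi(x,y,z)=\alpha(x)\ast\psi(y,z)+\alpha(y)\ast\psi(x,z)+\alpha(z)\ast\psi(x,y)+\psi(x\ast y,\alpha(z))+\psi(x\ast z,\alpha(y))+\psi(y\ast z,\alpha(x)),$$ $$\delta^1_{-1}N(x,y)=x\ast N(y)+y\ast N(x)-N(x\ast y).$$ Being in the same cohomology class means that $\psi_1,\psi_2\in Z^2_\alpha(A,A)$ and $\psi_2-\psi_1\in B^2_\alpha(A,A)$.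
   Formalization: The field K is assumed to be infinite or to have at least 4 elements; with deformations and equivalence required only for all t in K, the claim fails over the fields with 2 and 3 elements. *)

theory Defs
  imports Complex_Main
begin

text \<open>The vector space \<open>A\<close> is the whole type \<open>'a\<close>, with scalar
  multiplication \<open>scale\<close> by the field type \<open>'k\<close>. Linear maps on
  \<open>A \<otimes> A\<close> are represented by curried bilinear maps.\<close>

definition bilinear_on ::
    "('k::field \<Rightarrow> 'a::ab_group_add \<Rightarrow> 'a) \<Rightarrow> ('a \<Rightarrow> 'a \<Rightarrow> 'a) \<Rightarrow> bool" where
  "bilinear_on scale f \<longleftrightarrow>
     (\<forall>x. Vector_Spaces.linear scale scale (\<lambda>y. f x y)) \<and>
     (\<forall>y. Vector_Spaces.linear scale scale (\<lambda>x. f x y))"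

locale hom_jacobi_jordan_algebra = vector_space scale
  for scale :: "'k::field \<Rightarrow> 'a::ab_group_add \<Rightarrow> 'a" +
  fixes mul :: "'a \<Rightarrow> 'a \<Rightarrow> 'a" and \<alpha> :: "'a \<Rightarrow> 'a"
  assumes bilinear_mul: "bilinear_on scale mul"
    and linear_twist: "Vector_Spaces.linear scale scale \<alpha>"
    and multiplicative: "\<alpha> (mul x y) = mul (\<alpha> x) (\<alpha> y)"
    and commutative: "mul x y = mul y x"
    and hom_jacobi:
      "mul (mul x y) (\<alpha> z) + mul (mul y z) (\<alpha> x) + mul (mul z x) (\<alpha> y) = 0"

locale regular_hom_jacobi_jordan_algebra = hom_jacobi_jordan_algebra +
  assumes regular: "bij \<alpha>"

definition hjj_morphism ::
    "('k::field \<Rightarrow> 'a::ab_group_add \<Rightarrow> 'a) \<Rightarrow> ('a \<Rightarrow> 'a \<Rightarrow> 'a) \<Rightarrow> ('a \<Rightarrow> 'a) \<Rightarrow>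
     ('k \<Rightarrow> 'b::ab_group_add \<Rightarrow> 'b) \<Rightarrow> ('b \<Rightarrow> 'b \<Rightarrow> 'b) \<Rightarrow> ('b \<Rightarrow> 'b) \<Rightarrow>
     ('a \<Rightarrow> 'b) \<Rightarrow> bool" where
  "hjj_morphism scaleA \<mu> \<alpha> scaleB \<nu> \<beta> f \<longleftrightarrow>
     hom_jacobi_jordan_algebra scaleA \<mu> \<alpha> \<and>
     hom_jacobi_jordan_algebra scaleB \<nu> \<beta> \<and>
     Vector_Spaces.linear scaleA scaleB f \<and>
     (\<forall>x. f (\<alpha> x) = \<beta> (f x)) \<and>
     (\<forall>x y. f (\<mu> x y) = \<nu> (f x) (f y))"

definition cochains1 ::
    "('k::field \<Rightarrow> 'a::ab_group_add \<Rightarrow> 'a) \<Rightarrow> ('a \<Rightarrow> 'a) \<Rightarrow> ('a \<Rightarrow> 'a) set" where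
  "cochains1 scale \<alpha> =
     {f. Vector_Spaces.linear scale scale f \<and> (\<forall>x. f (\<alpha> x) = \<alpha> (f x))}"

definition cochains2 ::
    "('k::field \<Rightarrow> 'a::ab_group_add \<Rightarrow> 'a) \<Rightarrow> ('a \<Rightarrow> 'a) \<Rightarrow> ('a \<Rightarrow> 'a \<Rightarrow> 'a) set" where
  "cochains2 scale \<alpha> =
     {f. bilinear_on scale f \<and> (\<forall>x y. f (\<alpha> x) (\<alpha> y) = \<alpha> (f x y))}"

definition deform ::
    "('k::field \<Rightarrow> 'a::ab_group_add \<Rightarrow> 'a) \<Rightarrow> ('a \<Rightarrow> 'a \<Rightarrow> 'a) \<Rightarrow> ('a \<Rightarrow> 'a \<Rightarrow> 'a) \<Rightarrow>
     'k \<Rightarrow> 'a \<Rightarrow> 'a \<Rightarrow> 'a" where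
  "deform scale mul \<psi> t u v = mul u v + scale t (\<psi> u v)"

definition generates_linear_deformation ::
    "('k::field \<Rightarrow> 'a::ab_group_add \<Rightarrow> 'a) \<Rightarrow> ('a \<Rightarrow> 'a \<Rightarrow> 'a) \<Rightarrow> ('a \<Rightarrow> 'a) \<Rightarrow>
     ('a \<Rightarrow> 'a \<Rightarrow> 'a) \<Rightarrow> bool" where
  "generates_linear_deformation scale mul \<alpha> \<psi> \<longleftrightarrow>
     \<psi> \<in> cochains2 scale \<alpha> \<and>
     (\<forall>t. hom_jacobi_jordan_algebra scale (deform scale mul \<psi> t) \<alpha>)"

text \<open>The morphisms \<open>Id + t N\<close> go from the second deformation to the first.\<close>

definition equivalent_deformations ::
    "('k::field \<Rightarrow> 'a::ab_group_add \<Rightarrow> 'a) \<Rightarrow> ('a \<Rightarrow> 'a \<Rightarrow> 'a) \<Rightarrow> ('a \<Rightarrow> 'a) \<Rightarrow>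
     ('a \<Rightarrow> 'a \<Rightarrow> 'a) \<Rightarrow> ('a \<Rightarrow> 'a \<Rightarrow> 'a) \<Rightarrow> bool" where
  "equivalent_deformations scale mul \<alpha> \<psi>1 \<psi>2 \<longleftrightarrow>
     (\<exists>N. Vector_Spaces.linear scale scale N \<and>
       (\<forall>t. hjj_morphism scale (deform scale mul \<psi>2 t) \<alpha>
                         scale (deform scale mul \<psi>1 t) \<alpha>
                         (\<lambda>x. x + scale t (N x))))"

text \<open>Coboundary maps with coefficients in the representation
  \<open>u \<mapsto> (v \<mapsto> \<alpha>\<inverse>(u) * v)\<close>. Its values occur only at
  \<open>\<alpha>\<^sup>2(x)\<close> in degree two and at \<open>\<alpha>(x)\<close> in degree one, so the inverse
  of the twist cancels.\<close>

definition d2 ::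
    "('a::ab_group_add \<Rightarrow> 'a \<Rightarrow> 'a) \<Rightarrow> ('a \<Rightarrow> 'a) \<Rightarrow> ('a \<Rightarrow> 'a \<Rightarrow> 'a) \<Rightarrow>
     'a \<Rightarrow> 'a \<Rightarrow> 'a \<Rightarrow> 'a" where
  "d2 mul \<alpha> \<psi> x y z =
     mul (\<alpha> x) (\<psi> y z) + mul (\<alpha> y) (\<psi> x z) + mul (\<alpha> z) (\<psi> x y)
     + \<psi> (mul x y) (\<alpha> z) + \<psi> (mul x z) (\<alpha> y) + \<psi> (mul y z) (\<alpha> x)"

definition delta1 ::
    "('a::ab_group_add \<Rightarrow> 'a \<Rightarrow> 'a) \<Rightarrow> ('a \<Rightarrow> 'a) \<Rightarrow> 'a \<Rightarrow> 'a \<Rightarrow> 'a" where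
  "delta1 mul N x y = mul x (N y) + mul y (N x) - N (mul x y)"

definition cocycles2 ::
    "('k::field \<Rightarrow> 'a::ab_group_add \<Rightarrow> 'a) \<Rightarrow> ('a \<Rightarrow> 'a \<Rightarrow> 'a) \<Rightarrow> ('a \<Rightarrow> 'a) \<Rightarrow>
     ('a \<Rightarrow> 'a \<Rightarrow> 'a) set" where
  "cocycles2 scale mul \<alpha> = {\<psi> \<in> cochains2 scale \<alpha>. \<forall>x y z. d2 mul \<alpha> \<psi> x y z = 0}"

definition coboundaries2 ::
    "('k::field \<Rightarrow> 'a::ab_group_add \<Rightarrow> 'a) \<Rightarrow> ('a \<Rightarrow> 'a \<Rightarrow> 'a) \<Rightarrow> ('a \<Rightarrow> 'a) \<Rightarrow>
     ('a \<Rightarrow> 'a \<Rightarrow> 'a) set" where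
  "coboundaries2 scale mul \<alpha> = delta1 mul ` cochains1 scale \<alpha>"

text \<open>Equality of the classes of two cocycles in
  \<open>H\<^sup>2 = cocycles2 / coboundaries2\<close>.\<close>

definition same_cohomology_class ::
    "('k::field \<Rightarrow> 'a::ab_group_add \<Rightarrow> 'a) \<Rightarrow> ('a \<Rightarrow> 'a \<Rightarrow> 'a) \<Rightarrow> ('a \<Rightarrow> 'a) \<Rightarrow>
     ('a \<Rightarrow> 'a \<Rightarrow> 'a) \<Rightarrow> ('a \<Rightarrow> 'a \<Rightarrow> 'a) \<Rightarrow> bool" where
  "same_cohomology_class scale mul \<alpha> \<psi>1 \<psi>2 \<longleftrightarrow>
     \<psi>1 \<in> cocycles2 scale mul \<alpha> \<and> \<psi>2 \<in> cocycles2 scale mul \<alpha> \<and>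
     (\<lambda>x y. \<psi>2 x y - \<psi>1 x y) \<in> coboundaries2 scale mul \<alpha>"

text \<open>Deformations and equivalences are required pointwise for all \<open>t\<close> in
  \<open>'k\<close>. The equivalence condition is polynomial of degree three in \<open>t\<close>
  without constant term, so its linear coefficient is determined only if
  \<open>'k\<close> has at least four elements. With fewer elements cohomologous need not
  follow: for zero \<open>mul\<close>, identity \<open>\<alpha>\<close> and any nonzero
  symmetric bilinear \<open>\<psi>\<close> with \<open>\<psi> (\<psi> x y) z = 0\<close>, the operator
  \<open>N = - Id\<close> makes \<open>0\<close> and \<open>\<psi>\<close> equivalent over the field with two
  elements, and \<open>N = Id\<close> makes \<open>\<psi>\<close> and \<open>- \<psi>\<close> equivalent over
  the field with three.\<close>

end

theory Submission
  imports Defs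
begin

text \<open>Both parts of the conclusion are first-order terms in \<open>t\<close> of identities that hold for every
  \<open>t\<close>. The Hom-Jacobi identity of \<open>deform scale mul \<psi> t\<close> has the form \<open>t d + t\<^sup>2 e = 0\<close>, where \<open>d\<close>
  is \<open>d2 mul \<alpha> \<psi>\<close> up to commutativity, so each \<open>\<psi>\<close> is a cocycle. That \<open>Id + t N\<close> respects the
  products has the form \<open>t a + t\<^sup>2 b + t\<^sup>3 c = 0\<close> with
  \<open>a = \<psi>2 x y - \<psi>1 x y - delta1 mul N x y\<close>, so \<open>\<psi>2 - \<psi>1\<close> is the coboundary of \<open>N\<close>; that \<open>N\<close> commutes
  with the twist is read off at \<open>t = 1\<close>.

  A cubic without constant term that vanishes on the whole field has vanishing linear coefficient
  once the field has three nonzero elements (\<open>linear_coefficient_eq_0\<close>): dividing by \<open>t\<close> leaves a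
  quadratic with three roots. This is where the size of the field enters.\<close>

lemma exists_three_distinct_nonzero:
  assumes "infinite (UNIV :: 'k::zero set) \<or> card (UNIV :: 'k::zero set) \<ge> 4"
  obtains r s t :: "'k::zero" where "r \<noteq> 0" "s \<noteq> 0" "t \<noteq> 0" "r \<noteq> s" "r \<noteq> t" "s \<noteq> t"
proof -
  obtain F :: "'k set" where F: "finite F" "card F = 4"
    using assms by (metis infinite_arbitrarily_large obtain_subset_with_card_n)
  have "card (F - {0}) \<ge> 3"
    using F by (simp add: card_Diff_singleton_if)
  then obtain T where "T \<subseteq> F - {0}" "card T = 3"
    by (metis obtain_subset_with_card_n)
  then show thesis
    using that by (auto simp: card_3_iff)
qed

context vector_space
begin

lemma quadratic_constant_coefficient_eq_0:
  assumes zero: "\<And>t. t \<in> {r, s, u} \<Longrightarrow> a + scale t b + scale (t ^ 2) c = 0"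
    and distinct: "r \<noteq> s" "r \<noteq> u" "s \<noteq> u"
  shows "a = 0"
proof -
  have divided_difference: "b + scale (p + q) c = 0"
    if "p \<in> {r, s, u}" "q \<in> {r, s, u}" "p \<noteq> q" for p q
  proof -
    have "scale (p - q) (b + scale (p + q) c)
        = (a + scale p b + scale (p ^ 2) c) - (a + scale q b + scale (q ^ 2) c)"
      by (simp add: algebra_simps power2_eq_square)
    also have "\<dots> = 0"
      using zero that by simp
    finally show ?thesis
      using that by simp
  qed
  have "scale (s - u) c = (b + scale (r + s) c) - (b + scale (r + u) c)"
    by (simp add: algebra_simps)
  also have "\<dots> = 0"
    using divided_difference[of r s] divided_difference[of r u] distinct by simp
  finally have c: "c = 0"
    using distinct by simp
  then have b: "b = 0"
    using divided_difference[of r s] distinct by simp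
  show ?thesis
    using zero[of r] b c by simp
qed

lemma linear_coefficient_eq_0:
  assumes large: "infinite (UNIV :: 'a set) \<or> card (UNIV :: 'a set) \<ge> 4"
    and zero: "\<And>t. scale t a + scale (t ^ 2) b + scale (t ^ 3) c = 0"
  shows "a = 0"
proof -
  obtain r s u :: 'a where nonzero: "r \<noteq> 0" "s \<noteq> 0" "u \<noteq> 0"
    and distinct: "r \<noteq> s" "r \<noteq> u" "s \<noteq> u"
    using exists_three_distinct_nonzero[OF large] by metis
  have "a + scale t b + scale (t ^ 2) c = 0" if "t \<noteq> 0" for t
  proof -
    have "scale t (a + scale t b + scale (t ^ 2) c) = 0"
      using zero[of t] by (simp add: scale_right_distrib power2_eq_square power3_eq_cube mult.assoc)
    then show ?thesis
      using that by simp
  qed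
  then show ?thesis
    using quadratic_constant_coefficient_eq_0[OF _ distinct] nonzero by blast
qed

end

lemma bilinear_onD:
  assumes "bilinear_on scale f"
  shows "f (x + y) z = f x z + f y z" "f x (y + z) = f x y + f x z"
    "f (scale t x) y = scale t (f x y)" "f x (scale t y) = scale t (f x y)"
  using assms by (simp_all add: bilinear_on_def Vector_Spaces.linear_iff)

text \<open>Subtracting the undeformed product from the deformed one at \<open>t = 1\<close> transfers commutativity.\<close>

lemma deformation_commutative:
  assumes "hom_jacobi_jordan_algebra scale mul \<alpha>"
    and "generates_linear_deformation scale mul \<alpha> \<psi>"
  shows "\<psi> x y = \<psi> y x"
proof -
  interpret hom_jacobi_jordan_algebra scale mul \<alpha> by fact
  interpret deformed: hom_jacobi_jordan_algebra scale "deform scale mul \<psi> 1" \<alpha>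
    using assms(2) by (simp add: generates_linear_deformation_def)
  show ?thesis
    using deformed.commutative[of x y] commutative[of x y] by (simp add: deform_def)
qed

text \<open>In the Hom-Jacobi identity for \<open>x * y + t \<psi>(x, y)\<close> the constant term is the Hom-Jacobi identity
  of the original product and the coefficient of \<open>t\<close> is \<open>d2\<close>, which is not written cyclically: its
  agreement with the cyclic sum uses that \<open>\<psi>\<close> and the product are commutative.\<close>

lemma deformation_cocycle:
  fixes scale :: "'k::field \<Rightarrow> 'a::ab_group_add \<Rightarrow> 'a"
  assumes large: "infinite (UNIV :: 'k set) \<or> card (UNIV :: 'k set) \<ge> 4"
    and alg: "hom_jacobi_jordan_algebra scale mul \<alpha>"
    and gen: "generates_linear_deformation scale mul \<alpha> \<psi>"
  shows "\<psi> \<in> cocycles2 scale mul \<alpha>"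
proof -
  interpret hom_jacobi_jordan_algebra scale mul \<alpha> by fact
  have cochain: "\<psi> \<in> cochains2 scale \<alpha>"
    using gen by (simp add: generates_linear_deformation_def)
  then have "bilinear_on scale \<psi>"
    by (simp add: cochains2_def)
  note bilinear = bilinear_onD[OF bilinear_mul] bilinear_onD[OF this]
  have "d2 mul \<alpha> \<psi> x y z = 0" for x y z
  proof (rule linear_coefficient_eq_0[OF large])
    fix t
    let ?m = "deform scale mul \<psi> t"
    interpret deformed: hom_jacobi_jordan_algebra scale ?m \<alpha>
      using gen by (simp add: generates_linear_deformation_def)
    let ?e = "\<psi> (\<psi> x y) (\<alpha> z) + \<psi> (\<psi> y z) (\<alpha> x) + \<psi> (\<psi> z x) (\<alpha> y)"
    have d2_cyclic: "d2 mul \<alpha> \<psi> x y z =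
        mul (\<psi> x y) (\<alpha> z) + \<psi> (mul x y) (\<alpha> z) + (mul (\<psi> y z) (\<alpha> x) + \<psi> (mul y z) (\<alpha> x))
        + (mul (\<psi> z x) (\<alpha> y) + \<psi> (mul z x) (\<alpha> y))"
      unfolding d2_def
      using commutative[of "\<alpha> x"] commutative[of "\<alpha> y"] commutative[of "\<alpha> z"] commutative[of z x]
        deformation_commutative[OF alg gen, of z x]
      by (simp add: algebra_simps)
    have "?m (?m x y) (\<alpha> z) + ?m (?m y z) (\<alpha> x) + ?m (?m z x) (\<alpha> y)
        = (mul (mul x y) (\<alpha> z) + mul (mul y z) (\<alpha> x) + mul (mul z x) (\<alpha> y))
          + (scale t (d2 mul \<alpha> \<psi> x y z) + scale (t ^ 2) ?e)"
      unfolding d2_cyclic deform_def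
      by (simp add: bilinear scale_right_distrib power2_eq_square ac_simps)
    then show "scale t (d2 mul \<alpha> \<psi> x y z) + scale (t ^ 2) ?e + scale (t ^ 3) 0 = 0"
      by (simp add: deformed.hom_jacobi hom_jacobi)
  qed
  with cochain show ?thesis
    by (simp add: cocycles2_def)
qed

text \<open>Comparing the coefficients of \<open>t\<close> in
  \<open>T(x * y + t \<psi>2(x, y)) = T x * T y + t \<psi>1(T x, T y)\<close> for \<open>T = Id + t N\<close>; the right-hand side
  contributes the term \<open>t\<^sup>3 \<psi>1(N x, N y)\<close>, which is why cubic polynomials are needed.\<close>

lemma equivalent_deformations_differ_by_coboundary:
  fixes scale :: "'k::field \<Rightarrow> 'a::ab_group_add \<Rightarrow> 'a"
  assumes large: "infinite (UNIV :: 'k set) \<or> card (UNIV :: 'k set) \<ge> 4"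
    and alg: "hom_jacobi_jordan_algebra scale mul \<alpha>"
    and bilinear_\<psi>1: "bilinear_on scale \<psi>1"
    and equivalent: "equivalent_deformations scale mul \<alpha> \<psi>1 \<psi>2"
  shows "(\<lambda>x y. \<psi>2 x y - \<psi>1 x y) \<in> coboundaries2 scale mul \<alpha>"
proof -
  interpret hom_jacobi_jordan_algebra scale mul \<alpha> by fact
  obtain N where linear_N: "Vector_Spaces.linear scale scale N"
    and morphism: "\<And>t. hjj_morphism scale (deform scale mul \<psi>2 t) \<alpha>
      scale (deform scale mul \<psi>1 t) \<alpha> (\<lambda>x. x + scale t (N x))"
    using equivalent by (auto simp: equivalent_deformations_def)
  have linearity: "N (x + y) = N x + N y" "N (scale t x) = scale t (N x)"
    "\<alpha> (x + y) = \<alpha> x + \<alpha> y" for t x y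
    using linear_N linear_twist by (simp_all add: Vector_Spaces.linear_iff)
  note bilinear = bilinear_onD[OF bilinear_mul] bilinear_onD[OF bilinear_\<psi>1]
  have "N (\<alpha> x) = \<alpha> (N x)" for x
    using morphism[of 1] by (simp add: hjj_morphism_def linearity)
  then have cochain: "N \<in> cochains1 scale \<alpha>"
    using linear_N by (simp add: cochains1_def)
  have "\<psi>2 x y - \<psi>1 x y - delta1 mul N x y = 0" for x y
  proof (rule linear_coefficient_eq_0[OF large])
    fix t
    let ?b = "N (\<psi>2 x y) - mul (N x) (N y) - \<psi>1 x (N y) - \<psi>1 (N x) y"
    let ?c = "- \<psi>1 (N x) (N y)"
    let ?T = "\<lambda>x. x + scale t (N x)"
    have "scale t (\<psi>2 x y - \<psi>1 x y - delta1 mul N x y) + scale (t ^ 2) ?b + scale (t ^ 3) ?c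
        = ?T (deform scale mul \<psi>2 t x y) - deform scale mul \<psi>1 t (?T x) (?T y)"
      unfolding deform_def delta1_def commutative[of y "N x"]
      by (simp add: bilinear linearity scale_right_distrib scale_right_diff_distrib
          power2_eq_square power3_eq_cube algebra_simps)
    also have "\<dots> = 0"
      using morphism[of t] by (simp add: hjj_morphism_def)
    finally show "scale t (\<psi>2 x y - \<psi>1 x y - delta1 mul N x y) + scale (t ^ 2) ?b
        + scale (t ^ 3) ?c = 0" .
  qed
  then have "(\<lambda>x y. \<psi>2 x y - \<psi>1 x y) = delta1 mul N"
    by (intro ext) simp
  with cochain show ?thesis
    by (simp add: coboundaries2_def)
qed

theorem theorem5p8:
  fixes scale :: "'k::field \<Rightarrow> 'a::ab_group_add \<Rightarrow> 'a"
    and mul :: "'a \<Rightarrow> 'a \<Rightarrow> 'a" and \<alpha> :: "'a \<Rightarrow> 'a"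
    and \<psi>1 \<psi>2 :: "'a \<Rightarrow> 'a \<Rightarrow> 'a"
  assumes "infinite (UNIV :: 'k set) \<or> card (UNIV :: 'k set) \<ge> 4"
    and "regular_hom_jacobi_jordan_algebra scale mul \<alpha>"
    and "generates_linear_deformation scale mul \<alpha> \<psi>1"
    and "generates_linear_deformation scale mul \<alpha> \<psi>2"
    and "equivalent_deformations scale mul \<alpha> \<psi>1 \<psi>2"
  shows "same_cohomology_class scale mul \<alpha> \<psi>1 \<psi>2"
proof -
  have alg: "hom_jacobi_jordan_algebra scale mul \<alpha>"
    using assms(2) by (rule regular_hom_jacobi_jordan_algebra.axioms)
  have "bilinear_on scale \<psi>1"
    using assms(3) by (simp add: generates_linear_deformation_def cochains2_def)
  then show ?thesis
    unfolding same_cohomology_class_def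
    using deformation_cocycle[OF assms(1) alg] assms(3-5)
      equivalent_deformations_differ_by_coboundary[OF assms(1) alg]
    by blast
qed

end
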